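(* Let $X$ be independent of $\mathcal{D}_n$ and let $T(\mathbf{f_k}(X))=\mathbb{E}(f(X)\mid\mathbf{f_k}(X))$. Then $$\mathbb{E}|\hat{f}_{\mathrm{agg}}(X)-f(X)|^2\leq \min_{m=1,\dots,M} \mathbb{E}|f_m(X)-f(X)|^2+\mathbb{E}|\hat{f}_{\mathrm{agg}}(X)-T(\mathbf{f_k}(X))|^2 .$$
   Context: $\mu$ is Lebesgue measure on $\mathbb{R}^d$. $f$ is a probability density on $\mathbb{R}^d$, bounded from above, $X$ is a random vector with density $f$, and $f(X)\in L^2$. $\mathcal{D}_n=\{X_1,\dots,X_n\}$ are iid random vectors with the same distribution as $X$. The sample is split into $\mathcal{D}_k=\{X_1,\dots,X_k\}$ and $\mathcal{E}_l=\{X_{k+1},\dots,X_n\}$ with $l=n-k$. $\mathbf{f_k}(x)=(f_1(x),\dots,f_M(x))$ is a vector of $M$ density estimators computed from the first sample $\mathcal{D}_k$ only (so each $f_m$ is a random function depending on $\mathcal{D}_k$). For $\epsilon>0$ (fixed) and $x\in\mathbb{R}^d$, $$B(\epsilon,x)=\{y\in\mathbb{R}^d: |f_m(y)-f_m(x)|<\epsilon \text{ for all } m=1,\dots,M\}.$$ The aggregated density estimator is $$\hat{f}_{\mathrm{agg}}(x)=\frac{\sum_{j=1}^l \mathbb{I}_{B(\epsilon,x)}(X_{k+j})}{l\,\mu(B(\epsilon,x))},$$ where $\mathbb{I}_A$ is the indicator function of $A$.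
   Formalization: The conditional expectation defining T is taken with the first sample D_k held fixed, so T may depend on D_k, i.e. E(f(X) | f_k(X), D_k); conditioning on the random vector f_k(X) alone, with D_k averaged out, makes the inequality false. *)

theory Defs
  imports "HOL-Probability.Probability"
begin

definition level_nbhd :: "('v \<Rightarrow> real ^ 'm) \<Rightarrow> real \<Rightarrow> 'v \<Rightarrow> 'v set" where
  "level_nbhd g \<epsilon> x = {y. \<forall>m. \<bar>g y $ m - g x $ m\<bar> < \<epsilon>}"

(* fk maps a sample (x_1,...,x_k), encoded as an extensional function on {1..k}, to the vector
   of estimators computed from it.  If the neighbourhood has infinite volume, "measure" returns 0
   and the quotient is 0, which agrees with the convention c / infinity = 0; 0 / 0 is read as 0. *)
definition agg_density ::
  "((nat \<Rightarrow> 'v::euclidean_space) \<Rightarrow> 'v \<Rightarrow> real ^ 'm) \<Rightarrow> real \<Rightarrow> nat \<Rightarrow> nat \<Rightarrow> (nat \<Rightarrow> 'v) \<Rightarrow> 'v \<Rightarrow> real"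
where
  "agg_density fk \<epsilon> k l xs x =
    (let B = level_nbhd (fk (restrict xs {1..k})) \<epsilon> x
     in (\<Sum>j=1..l. indicator B (xs (k + j))) / (real l * measure lborel B))"

(* t(Z) is a version of E(Y | Z).  For estimators fk computed from a random sample D, this is used
   with Z = fk d X for almost every realisation d of D, so that the estimators are fixed functions
   when the conditional expectation is taken and t = T d may depend on d.  (Conditioning on the
   random vector fk D X alone, with D not held fixed, would mix different estimators.) *)
definition is_regression_fun ::
  "'w measure \<Rightarrow> ('w \<Rightarrow> real) \<Rightarrow> ('w \<Rightarrow> 'b::topological_space) \<Rightarrow> ('b \<Rightarrow> real) \<Rightarrow> bool" where
  "is_regression_fun P Y Z t \<longleftrightarrow>
     t \<in> borel_measurable borel \<and>
     (AE \<omega> in P. t (Z \<omega>) = real_cond_exp P (vimage_algebra (space P) Z borel) Y \<omega>)"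

end

theory Submission
  imports Defs
begin

text \<open>For almost every fixed sample, the aggregated estimator is a function of \<open>fk d X\<close>, as is each
  single estimator. Since \<open>T\<close> is the \<open>L\<^sup>2\<close> projection of \<open>f X\<close> onto such functions, Pythagoras gives
  \<open>E(agg - f)\<^sup>2 = E(agg - T)\<^sup>2 + E(T - f)\<^sup>2\<close> and \<open>E(T - f)\<^sup>2 \<le> E(f\<^sub>m - f)\<^sup>2\<close> for fixed sample; as \<open>X\<close> is
  independent of the sample, integrating over the sample yields the claim.\<close>

section \<open>Square-integrable functions and the orthogonality of conditional expectation\<close>

lemma integrable_mult_of_square:
  fixes u v :: "'a \<Rightarrow> real"
  assumes [measurable]: "u \<in> borel_measurable M" "v \<in> borel_measurable M"
    and "integrable M (\<lambda>x. (u x)\<^sup>2)" "integrable M (\<lambda>x. (v x)\<^sup>2)"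
  shows "integrable M (\<lambda>x. u x * v x)"
proof (rule Bochner_Integration.integrable_bound)
  show "integrable M (\<lambda>x. (u x)\<^sup>2 + (v x)\<^sup>2)"
    using assms by simp
  have "\<bar>a * b\<bar> \<le> a\<^sup>2 + b\<^sup>2" for a b :: real
  proof -
    have "2 * (\<bar>a\<bar> * \<bar>b\<bar>) \<le> a\<^sup>2 + b\<^sup>2"
      using sum_squares_bound[of "\<bar>a\<bar>" "\<bar>b\<bar>"] by simp
    moreover have "0 \<le> \<bar>a\<bar> * \<bar>b\<bar>" by simp
    ultimately have "\<bar>a\<bar> * \<bar>b\<bar> \<le> a\<^sup>2 + b\<^sup>2" by linarith
    then show ?thesis by (simp add: abs_mult)
  qed
  then show "AE x in M. norm (u x * v x) \<le> norm ((u x)\<^sup>2 + (v x)\<^sup>2)"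
    by simp
qed simp

lemma integrable_square_diff:
  fixes u v :: "'a \<Rightarrow> real"
  assumes "u \<in> borel_measurable M" "v \<in> borel_measurable M"
    and "integrable M (\<lambda>x. (u x)\<^sup>2)" "integrable M (\<lambda>x. (v x)\<^sup>2)"
  shows "integrable M (\<lambda>x. (u x - v x)\<^sup>2)"
proof -
  have "integrable M (\<lambda>x. (u x)\<^sup>2 - 2 * (u x * v x) + (v x)\<^sup>2)"
    using assms integrable_mult_of_square[OF assms] by simp
  then show ?thesis
    by (simp add: power2_eq_square algebra_simps)
qed

text \<open>The residual \<open>t (Z \<omega>) - Y \<omega>\<close> is orthogonal to
  square-integrable functions of \<open>Z\<close>, and
  \<open>h (Z \<omega>) - t (Z \<omega>)\<close> is a function of \<open>Z\<close>, so the cross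
  term vanishes. Integrals in the extended nonnegative reals let \<open>h\<close> be any Borel
  function, which matters because nothing bounds the aggregated estimator in L^2.\<close>

lemma (in prob_space) regression_pythagoras:
  fixes Y :: "'a \<Rightarrow> real" and Z :: "'a \<Rightarrow> 'b::topological_space" and h t :: "'b \<Rightarrow> real"
  assumes Z[measurable]: "Z \<in> borel_measurable M"
    and Y[measurable]: "Y \<in> borel_measurable M" and Y2: "integrable M (\<lambda>\<omega>. (Y \<omega>)\<^sup>2)"
    and h[measurable]: "h \<in> borel_measurable borel"
    and t: "is_regression_fun M Y Z t"
  shows "(\<integral>\<^sup>+\<omega>. ennreal ((h (Z \<omega>) - Y \<omega>)\<^sup>2) \<partial>M)
    = (\<integral>\<^sup>+\<omega>. ennreal ((h (Z \<omega>) - t (Z \<omega>))\<^sup>2) \<partial>M) + (\<integral>\<^sup>+\<omega>. ennreal ((t (Z \<omega>) - Y \<omega>)\<^sup>2) \<partial>M)"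
proof -
  define F where "F = vimage_algebra (space M) Z borel"
  define C where "C = real_cond_exp M F Y"
  have tm[measurable]: "t \<in> borel_measurable borel" and tC: "AE \<omega> in M. t (Z \<omega>) = C \<omega>"
    using t by (auto simp: is_regression_fun_def F_def C_def)
  have sub: "subalgebra M F"
    unfolding F_def subalgebra_def
    by (auto simp: sets_vimage_algebra2 intro: measurable_sets[OF Z])
  interpret F: finite_measure_subalgebra M F
    using sub by unfold_locales
  have ZF: "Z \<in> measurable F borel"
    unfolding F_def by (rule measurable_vimage_algebra1) simp
  have Cm[measurable]: "C \<in> borel_measurable M"
    unfolding C_def by simp
  have Yi: "integrable M Y"
    using square_integrable_imp_integrable[OF Y Y2] .
  \<comment> \<open>Conditional Jensen for the square: \<open>C\<close> inherits
    square-integrability from \<open>Y\<close>. The regression function \<open>t\<close> is then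
    square-integrable along \<open>Z\<close> only through its almost sure equality with
    \<open>C\<close>.\<close>
  have "integrable M (\<lambda>\<omega>. (C \<omega>)\<^sup>2)"
    unfolding C_def
    by (rule F.integrable_convex_cond_exp[where I = UNIV]) (use Yi Y2 in \<open>auto intro: convex_power2\<close>)
  then have tZ2: "integrable M (\<lambda>\<omega>. (t (Z \<omega>))\<^sup>2)"
    by (rule integrable_cong_AE_imp) (use tC in auto)
  let ?u = "\<lambda>\<omega>. h (Z \<omega>) - t (Z \<omega>)" and ?v = "\<lambda>\<omega>. t (Z \<omega>) - Y \<omega>"
  have v2: "integrable M (\<lambda>\<omega>. (?v \<omega>)\<^sup>2)"
    by (rule integrable_square_diff) (use tZ2 Y2 in auto)
  show ?thesis
  \<comment> \<open>The cross term \<open>?u * ?v\<close> is known to be integrable only when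
    \<open>?u\<close> is in L^2; otherwise both sides are shown to be infinite.\<close>
  proof (cases "integrable M (\<lambda>\<omega>. (?u \<omega>)\<^sup>2)")
    case True
    have uF: "?u \<in> borel_measurable F"
      using measurable_compose[OF ZF h] measurable_compose[OF ZF tm] by simp
    have uY: "integrable M (\<lambda>\<omega>. ?u \<omega> * Y \<omega>)" and ut: "integrable M (\<lambda>\<omega>. ?u \<omega> * t (Z \<omega>))"
      by (rule integrable_mult_of_square; use True Y2 tZ2 in simp)+
    \<comment> \<open>Passing from \<open>t\<close> to \<open>C\<close> makes the defining property
      of conditional expectation available: tested against the \<open>F\<close>-measurable
      \<open>?u\<close>, \<open>C\<close> and \<open>Y\<close> have the same integral.\<close>
    have "(\<integral>\<omega>. ?u \<omega> * t (Z \<omega>) \<partial>M) = (\<integral>\<omega>. ?u \<omega> * C \<omega> \<partial>M)"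
      by (rule integral_cong_AE) (use tC in auto)
    also have "\<dots> = (\<integral>\<omega>. ?u \<omega> * Y \<omega> \<partial>M)"
      unfolding C_def using F.real_cond_exp_intg(2)[OF uY uF Y] by simp
    finally have "(\<integral>\<omega>. ?u \<omega> * t (Z \<omega>) - ?u \<omega> * Y \<omega> \<partial>M) = 0"
      using uY ut by simp
    then have uv0: "(\<integral>\<omega>. ?u \<omega> * ?v \<omega> \<partial>M) = 0"
      by (simp add: algebra_simps)
    have uv: "integrable M (\<lambda>\<omega>. ?u \<omega> * ?v \<omega>)"
      by (rule integrable_mult_of_square) (use True v2 in auto)
    have eq: "(h (Z \<omega>) - Y \<omega>)\<^sup>2 = (?u \<omega>)\<^sup>2 + 2 * (?u \<omega> * ?v \<omega>) + (?v \<omega>)\<^sup>2" for \<omega>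
      by (simp add: power2_eq_square algebra_simps)
    have hY2: "integrable M (\<lambda>\<omega>. (h (Z \<omega>) - Y \<omega>)\<^sup>2)"
      unfolding eq using True uv v2 by simp
    have "(\<integral>\<omega>. (h (Z \<omega>) - Y \<omega>)\<^sup>2 \<partial>M) = (\<integral>\<omega>. (?u \<omega>)\<^sup>2 \<partial>M) + (\<integral>\<omega>. (?v \<omega>)\<^sup>2 \<partial>M)"
      unfolding eq using True uv v2 uv0 by simp
    then show ?thesis
      using True v2 hY2 by (simp add: nn_integral_eq_integral)
  next
    case False
    \<comment> \<open>Since \<open>?u\<close> is the difference of
      \<open>h (Z \<omega>) - Y \<omega>\<close> and \<open>?v\<close>, and \<open>?v\<close> is in
      L^2, square-integrability of the former would carry over to \<open>?u\<close>.\<close>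
    have "\<not> integrable M (\<lambda>\<omega>. (h (Z \<omega>) - Y \<omega>)\<^sup>2)"
    proof
      assume "integrable M (\<lambda>\<omega>. (h (Z \<omega>) - Y \<omega>)\<^sup>2)"
      from this v2 have "integrable M (\<lambda>\<omega>. ((h (Z \<omega>) - Y \<omega>) - ?v \<omega>)\<^sup>2)"
        by (rule integrable_square_diff[rotated 2]) auto
      with False show False by simp
    qed
    moreover have "(\<integral>\<^sup>+\<omega>. ennreal ((g \<omega>)\<^sup>2) \<partial>M) = \<infinity>"
      if [measurable]: "g \<in> borel_measurable M" and "\<not> integrable M (\<lambda>\<omega>. (g \<omega>)\<^sup>2)" for g :: "'a \<Rightarrow> real"
      using that(2) by (auto simp: integrable_iff_bounded less_top[symmetric])
    ultimately show ?thesis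
      using False by simp
  qed
qed

section \<open>Independence and iterated integrals\<close>

lemma (in prob_space) indep_set_commute: "indep_set A B \<longleftrightarrow> indep_set B A"
  unfolding indep_sets2_eq by (metis Int_commute mult.commute)

text \<open>The library's \<open>indep_var\<close> forces both random variables to take values in the same type, so
  independence is expressed through the generated \<open>\<sigma>\<close>-algebras.\<close>

lemma (in prob_space) distr_Pair_indep_set:
  assumes U[measurable]: "U \<in> measurable M N1" and V[measurable]: "V \<in> measurable M N2"
    and ind: "indep_set (sets (vimage_algebra (space M) U N1)) (sets (vimage_algebra (space M) V N2))"
  shows "distr M N1 U \<Otimes>\<^sub>M distr M N2 V = distr M (N1 \<Otimes>\<^sub>M N2) (\<lambda>\<omega>. (U \<omega>, V \<omega>))"
proof (rule pair_measure_eqI)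
  interpret U: prob_space "distr M N1 U" by (rule prob_space_distr) simp
  interpret V: prob_space "distr M N2 V" by (rule prob_space_distr) simp
  show "sigma_finite_measure (distr M N1 U)" "sigma_finite_measure (distr M N2 V)" ..
  show "sets (distr M N1 U \<Otimes>\<^sub>M distr M N2 V) = sets (distr M (N1 \<Otimes>\<^sub>M N2) (\<lambda>\<omega>. (U \<omega>, V \<omega>)))"
    by simp
  fix A B assume "A \<in> sets (distr M N1 U)" "B \<in> sets (distr M N2 V)"
  then have [measurable]: "A \<in> sets N1" "B \<in> sets N2" by auto
  have "prob ((U -` A \<inter> space M) \<inter> (V -` B \<inter> space M)) = prob (U -` A \<inter> space M) * prob (V -` B \<inter> space M)"
    by (rule indep_setD[OF ind]) (auto intro: in_vimage_algebra)
  moreover have "(\<lambda>\<omega>. (U \<omega>, V \<omega>)) -` (A \<times> B) \<inter> space M = (U -` A \<inter> space M) \<inter> (V -` B \<inter> space M)"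
    by auto
  ultimately show "emeasure (distr M N1 U) A * emeasure (distr M N2 V) B
      = emeasure (distr M (N1 \<Otimes>\<^sub>M N2) (\<lambda>\<omega>. (U \<omega>, V \<omega>))) (A \<times> B)"
    by (simp add: emeasure_distr emeasure_eq_measure ennreal_mult)
qed

text \<open>Tonelli for the product law, pulled back to \<open>M\<close> in both variables. The
  inner integral freezes \<open>U\<close> at \<open>U \<omega>\<close> but still runs over
  \<open>M\<close>, so facts about conditional expectations on \<open>M\<close> apply to it.\<close>

lemma (in prob_space) nn_integral_indep_set:
  assumes U[measurable]: "U \<in> measurable M N1" and V[measurable]: "V \<in> measurable M N2"
    and ind: "indep_set (sets (vimage_algebra (space M) U N1)) (sets (vimage_algebra (space M) V N2))"
    and [measurable]: "\<phi> \<in> borel_measurable (N1 \<Otimes>\<^sub>M N2)"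
  shows "(\<integral>\<^sup>+\<omega>. \<phi> (U \<omega>, V \<omega>) \<partial>M) = (\<integral>\<^sup>+\<omega>. \<integral>\<^sup>+\<omega>'. \<phi> (U \<omega>, V \<omega>') \<partial>M \<partial>M)"
proof -
  interpret V: prob_space "distr M N2 V" by (rule prob_space_distr) simp
  have "(\<integral>\<^sup>+\<omega>. \<phi> (U \<omega>, V \<omega>) \<partial>M) = (\<integral>\<^sup>+p. \<phi> p \<partial>distr M (N1 \<Otimes>\<^sub>M N2) (\<lambda>\<omega>. (U \<omega>, V \<omega>)))"
    by (simp add: nn_integral_distr)
  also have "distr M (N1 \<Otimes>\<^sub>M N2) (\<lambda>\<omega>. (U \<omega>, V \<omega>)) = distr M N1 U \<Otimes>\<^sub>M distr M N2 V"
    using distr_Pair_indep_set[OF U V ind] by simp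
  also have "(\<integral>\<^sup>+p. \<phi> p \<partial>\<dots>) = (\<integral>\<^sup>+u. \<integral>\<^sup>+v. \<phi> (u, v) \<partial>distr M N2 V \<partial>distr M N1 U)"
    by (simp add: V.nn_integral_fst[symmetric])
  also have "\<dots> = (\<integral>\<^sup>+\<omega>. \<integral>\<^sup>+v. \<phi> (U \<omega>, v) \<partial>distr M N2 V \<partial>M)"
    by (rule nn_integral_distr) measurable
  also have "\<dots> = (\<integral>\<^sup>+\<omega>. \<integral>\<^sup>+\<omega>'. \<phi> (U \<omega>, V \<omega>') \<partial>M \<partial>M)"
    by (rule nn_integral_cong, rule nn_integral_distr) 
      (auto intro!: measurable_Pair2[of _ N1] dest: measurable_space)
  finally show ?thesis .
qed

section \<open>Measurability of the aggregated estimator\<close>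

text \<open>The aggregated estimator depends on its argument only through the value of the estimators
  there, which is the argument \<open>z\<close> here.\<close>

definition agg_of_value ::
  "((nat \<Rightarrow> 'v::euclidean_space) \<Rightarrow> 'v \<Rightarrow> real ^ 'm) \<Rightarrow> real \<Rightarrow> nat \<Rightarrow> nat \<Rightarrow> (nat \<Rightarrow> 'v) \<Rightarrow> real ^ 'm \<Rightarrow> real"
where
  "agg_of_value fk \<epsilon> k l xs z =
    (let B = {y. \<forall>m. \<bar>fk (restrict xs {1..k}) y $ m - z $ m\<bar> < \<epsilon>}
     in (\<Sum>j=1..l. indicator B (xs (k + j))) / (real l * measure lborel B))"

lemma agg_density_eq_agg_of_value:
  "agg_density fk \<epsilon> k l xs x = agg_of_value fk \<epsilon> k l xs (fk (restrict xs {1..k}) x)"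
  by (simp add: agg_density_def agg_of_value_def level_nbhd_def)

text \<open>Joint measurability serves two purposes: Tonelli over sample and point, and, by taking
  sections at a fixed sample, the Borel function of the estimator values required by
  \<open>regression_pythagoras\<close>.\<close>

lemma measurable_agg_of_value:
  fixes fk :: "(nat \<Rightarrow> 'v::euclidean_space) \<Rightarrow> 'v \<Rightarrow> real ^ 'm"
  assumes fk: "(\<lambda>(d, x). fk d x) \<in> borel_measurable (Pi\<^sub>M {1..k} (\<lambda>_. borel) \<Otimes>\<^sub>M borel)"
  shows "(\<lambda>(xs, z). agg_of_value fk \<epsilon> k l xs z)
    \<in> borel_measurable (Pi\<^sub>M {1..k + l} (\<lambda>_. borel) \<Otimes>\<^sub>M borel)"
proof -
  let ?S = "Pi\<^sub>M {1..k + l} (\<lambda>_. borel) :: (nat \<Rightarrow> 'v) measure"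
  let ?N = "(?S \<Otimes>\<^sub>M (borel :: (real ^ 'm) measure)) \<Otimes>\<^sub>M (borel :: 'v measure)"
  define B where "B = (\<lambda>(xs, z). {y. \<forall>m. \<bar>fk (restrict xs {1..k}) y $ m - z $ m\<bar> < \<epsilon>})"
  have res: "(\<lambda>xs. restrict xs {1..k}) \<in> measurable ?S (Pi\<^sub>M {1..k} (\<lambda>_. borel))"
    by (rule measurable_restrict_subset) auto
  have fkm: "(\<lambda>p. fk (restrict (fst (fst p)) {1..k}) (snd p)) \<in> borel_measurable ?N"
    by (rule measurable_compose[OF measurable_Pair fk, simplified case_prod_conv])
      (rule measurable_compose[OF _ res], measurable)
  have [measurable]: "(\<lambda>p. fk (restrict (fst (fst p)) {1..k}) (snd p) $ m) \<in> borel_measurable ?N" for m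
    by (rule measurable_compose[OF fkm borel_measurable_nth])
  note borel_measurable_nth[measurable]
  \<comment> \<open>The quantifier over the finite index type becomes a bounded one over
    \<open>UNIV\<close>, so that the rule for finite intersections applies.\<close>
  have memB: "Measurable.pred ?N (\<lambda>p. snd p \<in> B (fst p))"
    unfolding B_def case_prod_beta mem_Collect_eq
    by (subst ball_UNIV[symmetric], rule pred_intros_finite(3)[OF finite]) measurable
  have "(\<lambda>p. emeasure lborel (B p)) \<in> borel_measurable (?S \<Otimes>\<^sub>M borel)"
  proof (rule measurable_cong[THEN iffD1])
    \<comment> \<open>\<open>B p\<close> is the section at \<open>p\<close> of the measurable set
      \<open>?Q\<close>, so its volume is measurable in \<open>p\<close>.\<close>
    let ?Q = "{q \<in> space ((?S \<Otimes>\<^sub>M borel) \<Otimes>\<^sub>M lborel). snd q \<in> B (fst q)}"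
    show "(\<lambda>p. emeasure lborel (Pair p -` ?Q)) \<in> borel_measurable (?S \<Otimes>\<^sub>M borel)"
      by (rule lborel.measurable_emeasure_Pair)
        (use memB in \<open>simp add: pred_def space_pair_measure cong: measurable_cong_sets sets_pair_measure_cong\<close>)
    show "emeasure lborel (Pair p -` ?Q) = emeasure lborel (B p)"
      if "p \<in> space (?S \<Otimes>\<^sub>M borel)" for p :: "(nat \<Rightarrow> 'v) \<times> (real ^ 'm)"
      using that by (intro arg_cong[where f = "emeasure lborel"]) (auto simp: space_pair_measure)
  qed
  then have [measurable]: "(\<lambda>p. measure lborel (B p)) \<in> borel_measurable (?S \<Otimes>\<^sub>M borel)"
    unfolding measure_def by measurable
  have [measurable]: "(\<lambda>p. indicator (B p) (fst p (k + j)) :: real) \<in> borel_measurable (?S \<Otimes>\<^sub>M borel)"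
    if "j \<in> {1..l}" for j
  proof -
    \<comment> \<open>The indicator is the predicate \<open>memB\<close> composed with the map that
      takes the sample point \<open>k + j\<close> as the point to test; \<open>j \<le> l\<close>
      keeps this index within the sample.\<close>
    have "(\<lambda>p. (p, fst p (k + j))) \<in> measurable (?S \<Otimes>\<^sub>M borel) ?N"
      using that
      by (intro measurable_Pair measurable_ident
          measurable_compose[OF measurable_fst measurable_component_singleton])
        auto
    from measurable_compose[OF this memB]
    show ?thesis
      unfolding indicator_def of_bool_def by simp
  qed
  have "(\<lambda>p. (\<Sum>j=1..l. indicator (B p) (fst p (k + j))) / (real l * measure lborel (B p)))
      \<in> borel_measurable (?S \<Otimes>\<^sub>M borel)"
    by measurable
  then show ?thesis
    by (simp add: agg_of_value_def B_def case_prod_beta Let_def)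
qed

section \<open>The risk inequality: first for a frozen sample, then integrated over the
  sample\<close>

theorem proposition1:
  fixes P :: "'w measure"
    and X :: "'w \<Rightarrow> real ^ 'd"
    and Xs :: "nat \<Rightarrow> 'w \<Rightarrow> real ^ 'd"
    and f :: "real ^ 'd \<Rightarrow> real"
    and fk :: "(nat \<Rightarrow> real ^ 'd) \<Rightarrow> real ^ 'd \<Rightarrow> real ^ 'm"
    and T :: "(nat \<Rightarrow> real ^ 'd) \<Rightarrow> real ^ 'm \<Rightarrow> real"
    and D :: "'w \<Rightarrow> nat \<Rightarrow> real ^ 'd"
    and \<epsilon> :: real
    and n k l :: nat
  assumes "prob_space P"
    and "1 \<le> k" "k < n" and l: "l = n - k"
    and "\<epsilon> > 0"
    and "f \<in> borel_measurable borel" "\<And>x. 0 \<le> f x" "\<exists>C. \<forall>x. f x \<le> C"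
    and "distributed P lborel X (\<lambda>x. ennreal (f x))"
    and "integrable P (\<lambda>\<omega>. (f (X \<omega>))\<^sup>2)"
    and "prob_space.indep_vars P (\<lambda>_. borel) Xs {1..n}"
    and "\<And>i. i \<in> {1..n} \<Longrightarrow> distr P borel (Xs i) = distr P borel X"
    and "prob_space.indep_set P (sets (vimage_algebra (space P) X borel))
           (sets (vimage_algebra (space P) (\<lambda>\<omega>. \<lambda>i\<in>{1..n}. Xs i \<omega>)
                    (Pi\<^sub>M {1..n} (\<lambda>_. borel))))"
    and D: "D = (\<lambda>\<omega>. \<lambda>i\<in>{1..k}. Xs i \<omega>)"
    and "(\<lambda>(d, x). fk d x) \<in> borel_measurable (Pi\<^sub>M {1..k} (\<lambda>_. borel) \<Otimes>\<^sub>M borel)"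
    and "(\<lambda>(d, z). T d z) \<in> borel_measurable (Pi\<^sub>M {1..k} (\<lambda>_. borel) \<Otimes>\<^sub>M borel)"
    and "AE d in distr P (Pi\<^sub>M {1..k} (\<lambda>_. borel)) D.
           is_regression_fun P (\<lambda>\<omega>. f (X \<omega>)) (\<lambda>\<omega>. fk d (X \<omega>)) (T d)"
  shows "(\<integral>\<^sup>+\<omega>. ennreal (\<bar>agg_density fk \<epsilon> k l (\<lambda>i. Xs i \<omega>) (X \<omega>) - f (X \<omega>)\<bar>\<^sup>2) \<partial>P)
     \<le> (MIN m\<in>UNIV. \<integral>\<^sup>+\<omega>. ennreal (\<bar>fk (D \<omega>) (X \<omega>) $ m - f (X \<omega>)\<bar>\<^sup>2) \<partial>P)
       + (\<integral>\<^sup>+\<omega>. ennreal (\<bar>agg_density fk \<epsilon> k l (\<lambda>i. Xs i \<omega>) (X \<omega>)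
                 - T (D \<omega>) (fk (D \<omega>) (X \<omega>))\<bar>\<^sup>2) \<partial>P)"
proof -
  interpret prob_space P by fact
  let ?S = "Pi\<^sub>M {1..n} (\<lambda>_. borel) :: (nat \<Rightarrow> real ^ 'd) measure"
  let ?Dk = "Pi\<^sub>M {1..k} (\<lambda>_. borel) :: (nat \<Rightarrow> real ^ 'd) measure"
  note [measurable] = \<open>f \<in> borel_measurable borel\<close> borel_measurable_nth
  have n: "n = k + l" using \<open>k < n\<close> l by simp
  define S where "S = (\<lambda>\<omega>. \<lambda>i\<in>{1..n}. Xs i \<omega>)"
  have X[measurable]: "X \<in> borel_measurable P"
    using distributed_measurable[OF \<open>distributed P lborel X _\<close>] by simp
  have Xs: "Xs i \<in> borel_measurable P" if "i \<in> {1..n}" for i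
    using \<open>indep_vars _ Xs _\<close> that by (auto simp: indep_vars_def)
  have S[measurable]: "S \<in> measurable P ?S"
    unfolding S_def by (intro measurable_restrict Xs)
  have res[measurable]: "(\<lambda>xs. restrict xs {1..k}) \<in> measurable ?S ?Dk"
    by (rule measurable_restrict_subset) (use n in auto)
  have D_S: "D \<omega> = restrict (S \<omega>) {1..k}" for \<omega>
    unfolding D S_def using n by (auto simp: restrict_def)
  \<comment> \<open>Keeping \<open>One_nat_def\<close> out of the simplifier preserves the form
    \<open>{1..k}\<close>, which \<open>D_S\<close> must match.\<close>
  have Dm[measurable]: "D \<in> measurable P ?Dk"
    using measurable_compose[OF S res] by (simp add: D_S[symmetric] del: One_nat_def)
  have agg: "agg_density fk \<epsilon> k l (\<lambda>i. Xs i \<omega>) x = agg_of_value fk \<epsilon> k l (S \<omega>) (fk (D \<omega>) x)" for \<omega> x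
  proof -
    have "restrict (\<lambda>i. Xs i \<omega>) {1..k} = D \<omega>"
      by (simp add: D)
    moreover have "S \<omega> (k + j) = Xs (k + j) \<omega>" if "j \<in> {1..l}" for j
      using that n by (simp add: S_def)
    ultimately show ?thesis
      by (simp add: agg_density_eq_agg_of_value agg_of_value_def D_S[symmetric] del: One_nat_def)
  qed
  \<comment> \<open>Independence is flipped so that the sample is the outer variable and
    \<open>X\<close> the inner one.\<close>
  note nn_integral_decouple = nn_integral_indep_set[OF S X
      assms(13)[folded S_def, unfolded indep_set_commute[of "sets (vimage_algebra _ X _)"]]]
  \<comment> \<open>Estimators, aggregate and regression function are written as functions of the
    pair (full sample, point), the form that decoupling requires.\<close>
  define \<phi> where "\<phi> = (\<lambda>p. fk (restrict (fst p) {1..k}) (snd p))"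
  define \<alpha> where "\<alpha> = (\<lambda>p. agg_of_value fk \<epsilon> k l (fst p) (\<phi> p))"
  define \<tau> where "\<tau> = (\<lambda>p. T (restrict (fst p) {1..k}) (\<phi> p))"
  have [measurable]: "(\<lambda>p. restrict (fst p) {1..k}) \<in> measurable (?S \<Otimes>\<^sub>M borel) ?Dk"
    by (rule measurable_compose[OF measurable_fst res])
  have \<phi>[measurable]: "\<phi> \<in> borel_measurable (?S \<Otimes>\<^sub>M borel)"
    unfolding \<phi>_def
    by (rule measurable_compose[OF measurable_Pair assms(15), simplified case_prod_conv]) measurable
  have [measurable]: "\<alpha> \<in> borel_measurable (?S \<Otimes>\<^sub>M borel)"
    unfolding \<alpha>_def
    by (rule measurable_compose[OF measurable_Pair measurable_agg_of_value[OF assms(15)], simplified case_prod_conv])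
      (simp_all add: n[symmetric] \<phi> del: One_nat_def)
  have [measurable]: "\<tau> \<in> borel_measurable (?S \<Otimes>\<^sub>M borel)"
    unfolding \<tau>_def
    by (rule measurable_compose[OF measurable_Pair assms(16), simplified case_prod_conv]) measurable
  have reg: "AE \<omega> in P. is_regression_fun P (\<lambda>\<omega>'. f (X \<omega>')) (\<lambda>\<omega>'. \<phi> (S \<omega>, X \<omega>')) (T (D \<omega>))"
    using AE_distrD[OF Dm assms(17)] by (simp add: \<phi>_def D_S[symmetric] del: One_nat_def)
  \<comment> \<open>Here \<open>\<omega>\<close> fixes the sample and \<open>\<omega>'\<close>
    drives only \<open>X\<close>, so the estimators are deterministic functions under the
    integral.\<close>
  have pointwise: "(\<integral>\<^sup>+\<omega>'. ennreal ((\<alpha> (S \<omega>, X \<omega>') - f (X \<omega>'))\<^sup>2) \<partial>P)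
      \<le> (\<integral>\<^sup>+\<omega>'. ennreal ((\<phi> (S \<omega>, X \<omega>') $ m - f (X \<omega>'))\<^sup>2)
             + ennreal ((\<alpha> (S \<omega>, X \<omega>') - \<tau> (S \<omega>, X \<omega>'))\<^sup>2) \<partial>P)"
    if \<omega>: "\<omega> \<in> space P" and r: "is_regression_fun P (\<lambda>\<omega>'. f (X \<omega>')) (\<lambda>\<omega>'. \<phi> (S \<omega>, X \<omega>')) (T (D \<omega>))"
    for \<omega> m
  proof -
    have S\<omega>: "S \<omega> \<in> space ?S" using measurable_space[OF S \<omega>] .
    have pair: "(\<lambda>\<omega>'. (S \<omega>, X \<omega>')) \<in> measurable P (?S \<Otimes>\<^sub>M borel)"
      using S\<omega> by simp
    note sec = measurable_compose[OF pair]
    have \<phi>X[measurable]: "(\<lambda>\<omega>'. \<phi> (S \<omega>, X \<omega>')) \<in> borel_measurable P"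
      and [measurable]:
        "(\<lambda>\<omega>'. \<alpha> (S \<omega>, X \<omega>')) \<in> borel_measurable P"
        "(\<lambda>\<omega>'. \<tau> (S \<omega>, X \<omega>')) \<in> borel_measurable P"
      by (rule sec; measurable)+
    have A: "agg_of_value fk \<epsilon> k l (S \<omega>) \<in> borel_measurable borel"
      using measurable_Pair2[OF measurable_agg_of_value[OF assms(15), of \<epsilon> l] S\<omega>[unfolded n]] by simp
    note pyth = regression_pythagoras[where Y = "\<lambda>\<omega>'. f (X \<omega>')", OF \<phi>X _ assms(10) _ r]
    let ?R = "\<integral>\<^sup>+\<omega>'. ennreal ((\<tau> (S \<omega>, X \<omega>') - f (X \<omega>'))\<^sup>2) \<partial>P"
    have 1: "(\<integral>\<^sup>+\<omega>'. ennreal ((\<alpha> (S \<omega>, X \<omega>') - f (X \<omega>'))\<^sup>2) \<partial>P)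
        = (\<integral>\<^sup>+\<omega>'. ennreal ((\<alpha> (S \<omega>, X \<omega>') - \<tau> (S \<omega>, X \<omega>'))\<^sup>2) \<partial>P) + ?R"
      using pyth[OF _ A] by (simp add: \<alpha>_def \<phi>_def \<tau>_def D_S del: One_nat_def)
    \<comment> \<open>Pythagoras again, now with the projection to coordinate \<open>m\<close> as
      \<open>h\<close>; dropping its nonnegative first term leaves the bound.\<close>
    have "?R \<le> (\<integral>\<^sup>+\<omega>'. ennreal ((\<phi> (S \<omega>, X \<omega>') $ m - f (X \<omega>'))\<^sup>2) \<partial>P)"
      using pyth[OF _ borel_measurable_nth[of m]] by (simp add: \<phi>_def \<tau>_def D_S del: One_nat_def)
    then show ?thesis
      unfolding 1 by (subst nn_integral_add) (auto simp: add.commute intro: add_mono)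
  qed
  have main: "(\<integral>\<^sup>+\<omega>. ennreal ((\<alpha> (S \<omega>, X \<omega>) - f (X \<omega>))\<^sup>2) \<partial>P)
      \<le> (\<integral>\<^sup>+\<omega>. ennreal ((\<phi> (S \<omega>, X \<omega>) $ m - f (X \<omega>))\<^sup>2) \<partial>P)
        + (\<integral>\<^sup>+\<omega>. ennreal ((\<alpha> (S \<omega>, X \<omega>) - \<tau> (S \<omega>, X \<omega>))\<^sup>2) \<partial>P)" for m
  proof -
    have "(\<integral>\<^sup>+\<omega>. ennreal ((\<alpha> (S \<omega>, X \<omega>) - f (X \<omega>))\<^sup>2) \<partial>P)
        = (\<integral>\<^sup>+\<omega>. \<integral>\<^sup>+\<omega>'. ennreal ((\<alpha> (S \<omega>, X \<omega>') - f (X \<omega>'))\<^sup>2) \<partial>P \<partial>P)"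
      using nn_integral_decouple[of "\<lambda>p. ennreal ((\<alpha> p - f (snd p))\<^sup>2)"]
      by (simp del: One_nat_def)
    also have "\<dots> \<le> (\<integral>\<^sup>+\<omega>. \<integral>\<^sup>+\<omega>'. ennreal ((\<phi> (S \<omega>, X \<omega>') $ m - f (X \<omega>'))\<^sup>2)
             + ennreal ((\<alpha> (S \<omega>, X \<omega>') - \<tau> (S \<omega>, X \<omega>'))\<^sup>2) \<partial>P \<partial>P)"
      by (rule nn_integral_mono_AE) (use reg pointwise in auto)
    \<comment> \<open>Decoupling is applied backwards, returning to the joint law of sample and
      \<open>X\<close>.\<close>
    also have "\<dots> = (\<integral>\<^sup>+\<omega>. ennreal ((\<phi> (S \<omega>, X \<omega>) $ m - f (X \<omega>))\<^sup>2)
             + ennreal ((\<alpha> (S \<omega>, X \<omega>) - \<tau> (S \<omega>, X \<omega>))\<^sup>2) \<partial>P)"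
      using nn_integral_decouple[of "\<lambda>p. ennreal ((\<phi> p $ m - f (snd p))\<^sup>2) + ennreal ((\<alpha> p - \<tau> p)\<^sup>2)"]
      by (simp del: One_nat_def)
    also have "\<dots> = (\<integral>\<^sup>+\<omega>. ennreal ((\<phi> (S \<omega>, X \<omega>) $ m - f (X \<omega>))\<^sup>2) \<partial>P)
        + (\<integral>\<^sup>+\<omega>. ennreal ((\<alpha> (S \<omega>, X \<omega>) - \<tau> (S \<omega>, X \<omega>))\<^sup>2) \<partial>P)"
      by (rule nn_integral_add) measurable
    finally show ?thesis .
  qed
  \<comment> \<open>The minimum over the finite nonempty index type is attained, so the bound for
    one index \<open>m\<close> suffices.\<close>
  have "(MIN m\<in>UNIV. \<integral>\<^sup>+\<omega>. ennreal (\<bar>fk (D \<omega>) (X \<omega>) $ m - f (X \<omega>)\<bar>\<^sup>2) \<partial>P)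
      \<in> range (\<lambda>m. \<integral>\<^sup>+\<omega>. ennreal (\<bar>fk (D \<omega>) (X \<omega>) $ m - f (X \<omega>)\<bar>\<^sup>2) \<partial>P)"
    by (rule Min_in) auto
  then obtain m where m: "(MIN m\<in>UNIV. \<integral>\<^sup>+\<omega>. ennreal (\<bar>fk (D \<omega>) (X \<omega>) $ m - f (X \<omega>)\<bar>\<^sup>2) \<partial>P)
      = (\<integral>\<^sup>+\<omega>. ennreal (\<bar>fk (D \<omega>) (X \<omega>) $ m - f (X \<omega>)\<bar>\<^sup>2) \<partial>P)"
    by blast
  show ?thesis
    unfolding m agg using main[of m] by (simp add: \<alpha>_def \<phi>_def \<tau>_def D_S del: One_nat_def)
qed

end
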